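(* Let $\mathbb{M}\in\{\mathbb{R}^2,\mathbb{H}^2,\mathbb{S}^2\}$, let $\Gamma\subset\mathbb{M}$ be a circle of radius $r_0$, and let $0<\alpha<\frac{\pi}{6}$. The Lyapunov exponent of the random circular billiard map $\overline{F}$ is zero at every point, for every admissible sequence and in every direction: for all $(s,\theta)\in M=[0,2\pi h)\times(0,\pi)$, all $\underline{x}\in\Sigma_\theta$ and every nonzero vector $\vec{v}\in\mathbb{R}^2$ (tangent to $M$ at $(s,\theta)$), $$\lambda_{\underline{x}}(\vec{v},(s,\theta))=\lim_{n\to\infty}\frac1n\log\left\|D_{(s,\theta)}\overline{F}^{(n)}_{\underline{x}}\cdot\vec{v}\right\|=0 .$$
   Context: Circular billiards. $\mathbb{M}$ is the Euclidean plane $\mathbb{R}^2$, the hyperbolic plane $\mathbb{H}^2$ (curvature $-1$) or the unit sphere $\mathbb{S}^2$ (curvature $1$). $\Gamma$ is a geodesic circle of radius $r_0>0$ (with $r_0<\pi/2$ in $\mathbb{S}^2$). Put $h=r_0$, $\sinh r_0$, $\sin r_0$ respectively; $\Gamma$ has length $2\pi h$ and is identified by arc length with $[0,2\pi h)$ taken mod $2\pi h$. For $\theta\in[0,\pi]$, $\gamma(\theta)\in[0,2\pi]$ is the central angle from a point of $\Gamma$ to the next collision point when a particle leaves along a geodesic making angle $\theta$ with the oriented tangent of $\Gamma$; it does not depend on the point. Equivalently $\gamma$ is the continuous increasing function with $\gamma(0)=0$, $\gamma(\pi/2)=\pi$, $\gamma(\pi)=2\pi$ and $\tan(\gamma(\theta)/2)=\tan(\theta)/c$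 for $\theta\ne\pi/2$, where $c=1$, $\cosh r_0$, $\cos r_0$ respectively; it is smooth. Put $l(\gamma)=h\gamma$. Feres random map. $T_1(\theta)=\theta+2\alpha$, $T_2(\theta)=-\theta+2\pi-4\alpha$, $T_3(\theta)=\theta-2\alpha$, $T_4(\theta)=-\theta+4\alpha$. With $u_\beta(\theta)=\frac12\left(1+\frac{\tan\beta}{\tan\theta}\right)$, define on $[0,\pi]$: - $p_1=1$ on $[0,\alpha)$; $u_\alpha(\theta)$ on $[\alpha,\pi-3\alpha)$; $2\cos(2\alpha)u_{2\alpha}(\theta)$ on $[\pi-3\alpha,\pi-2\alpha)$; $0$ on $[\pi-2\alpha,\pi]$. - $p_2=0$ on $[0,\pi-3\alpha)$; $u_\alpha(\theta)-2\cos(2\alpha)u_{2\alpha}(\theta)$ on $[\pi-3\alpha,\pi-2\alpha)$; $u_\alpha(\theta)$ on $[\pi-2\alpha,\pi-\alpha)$; $0$ on $[\pi-\alpha,\pi]$. - $p_3=0$ on $[0,2\alpha)$; $2\cos(2\alpha)u_{2\alpha}(-\theta)$ on $[2\alpha,3\alpha)$; $u_\alpha(-\theta)$ on $[3\alpha,\pi-\alpha)$; $1$ on $[\pi-\alpha,\pi]$. - $p_4=0$ on $[0,\alpha)$; $u_\alpha(-\theta)$ on $[\alpha,2\alpha)$; $u_\alpha(-\theta)-2\cos(2\alpha)u_{2\alpha}(-\theta)$ on $[2\alpha,3\alpha)$; $0$ on $[3\alpha,\pi]$. The random circular billiard map is $\overline{F}(s,\theta)=\overline{F}_i(s,\theta):=(s+l(\gamma(T_i(\theta)))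 \bmod 2\pi h,\ T_i(\theta))$ with probability $p_i(\theta)$. For $\theta\in(0,\pi)$, $\Sigma_\theta$ is the set of $\underline{x}=(x_1,x_2,\dots)\in\{1,2,3,4\}^{\mathbb{N}}$ with $p_{x_1}(\theta)p_{x_2}(T_{x_1}(\theta))\cdots p_{x_k}(T_{x_{k-1}}\circ\cdots\circ T_{x_1}(\theta))>0$ for all $k\ge1$. For $\underline{x}\in\Sigma_\theta$ put $\overline{F}^{(n)}_{\underline{x}}=\overline{F}_{x_n}\circ\cdots\circ\overline{F}_{x_1}$; its derivative at $(s,\theta)$ is that of this composition with the indices $x_1,\dots,x_n$ held fixed and the first coordinate regarded in $\mathbb{R}/2\pi h\mathbb{Z}$. *)

theory Defs
  imports "HOL-Analysis.Analysis" "HOL-Library.Real_Mod"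
begin

subsection \<open>The three surfaces and the circle\<close>

text \<open>
  All three surfaces are realised in three-dimensional space with base point \<open>(0, 0, 1)\<close>: the
  affine plane \<open>z = 1\<close>, the upper sheet of the hyperboloid \<open>x\<^sup>2 + y\<^sup>2 - z\<^sup>2 = -1\<close> with the metric
  induced by \<open>dx\<^sup>2 + dy\<^sup>2 - dz\<^sup>2\<close>, and the unit sphere.  In each model the unit speed geodesic
  with initial point \<open>p\<close> and unit initial velocity \<open>v\<close> is \<open>t \<mapsto> cs t p + sn t v\<close>.
\<close>

datatype geometry = Euclidean | Hyperbolic | Spherical

fun curv :: "geometry \<Rightarrow> real" where
  "curv Euclidean = 0"
| "curv Hyperbolic = -1"
| "curv Spherical = 1"

fun sn :: "geometry \<Rightarrow> real \<Rightarrow> real" where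
  "sn Euclidean t = t"
| "sn Hyperbolic t = sinh t"
| "sn Spherical t = sin t"

fun cs :: "geometry \<Rightarrow> real \<Rightarrow> real" where
  "cs Euclidean t = 1"
| "cs Hyperbolic t = cosh t"
| "cs Spherical t = cos t"

type_synonym point3 = "real \<times> real \<times> real"

definition geodesic :: "geometry \<Rightarrow> point3 \<Rightarrow> point3 \<Rightarrow> real \<Rightarrow> point3" where
  "geodesic M p v t = cs M t *\<^sub>R p + sn M t *\<^sub>R v"

text \<open>
  By homogeneity the circle is centred at the base point.  The point with central angle \<open>\<phi>\<close> is
  reached at time \<open>r\<close> along the radial geodesic in direction \<open>(cos \<phi>, sin \<phi>, 0)\<close>.
\<close>

definition circ_point :: "geometry \<Rightarrow> real \<Rightarrow> real \<Rightarrow> point3" where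
  "circ_point M r \<phi> = geodesic M (0, 0, 1) (cos \<phi>, sin \<phi>, 0) r"

definition geod_circle :: "geometry \<Rightarrow> real \<Rightarrow> point3 set" where
  "geod_circle M r = range (circ_point M r)"

definition circ_tangent :: "real \<Rightarrow> point3" where
  "circ_tangent \<phi> = (- sin \<phi>, cos \<phi>, 0)"

text \<open>The inward unit normal is minus the velocity of the radial geodesic; note
  \<open>sn' = cs\<close> and \<open>cs' = - curv * sn\<close>.\<close>

definition inward_normal :: "geometry \<Rightarrow> real \<Rightarrow> real \<Rightarrow> point3" where
  "inward_normal M r \<phi> = (- cs M r * cos \<phi>, - cs M r * sin \<phi>, curv M * sn M r)"

definition trajectory :: "geometry \<Rightarrow> real \<Rightarrow> real \<Rightarrow> real \<Rightarrow> real \<Rightarrow> point3" where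
  "trajectory M r \<phi> \<theta> =
     geodesic M (circ_point M r \<phi>) (cos \<theta> *\<^sub>R circ_tangent \<phi> + sin \<theta> *\<^sub>R inward_normal M r \<phi>)"

definition next_collision :: "geometry \<Rightarrow> real \<Rightarrow> real \<Rightarrow> real \<Rightarrow> point3 \<Rightarrow> bool" where
  "next_collision M r \<phi> \<theta> q \<longleftrightarrow>
     (\<exists>t>0. trajectory M r \<phi> \<theta> t = q \<and> q \<in> geod_circle M r \<and>
        (\<forall>u. 0 < u \<and> u < t \<longrightarrow> trajectory M r \<phi> \<theta> u \<notin> geod_circle M r))"

text \<open>
  The tangential angles \<open>0\<close> and \<open>\<pi>\<close> get the continuous boundary values.  The values outside
  \<open>[0, \<pi>]\<close> are immaterial.
\<close>

definition central_angle :: "geometry \<Rightarrow> real \<Rightarrow> real \<Rightarrow> real" where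
  "central_angle M r \<theta> =
     (if \<theta> \<le> 0 then 0 else if pi \<le> \<theta> then 2 * pi
      else (THE g. 0 < g \<and> g < 2 * pi \<and>
              (\<forall>\<phi>. next_collision M r \<phi> \<theta> (circ_point M r (\<phi> + g)))))"

definition circ_length :: "geometry \<Rightarrow> real \<Rightarrow> real" where
  "circ_length M r = 2 * pi * sn M r"

definition arc :: "geometry \<Rightarrow> real \<Rightarrow> real \<Rightarrow> real" where
  "arc M r g = sn M r * g"

subsection \<open>The Feres random map and the random circular billiard map\<close>

datatype branch = B1 | B2 | B3 | B4

fun feres_map :: "real \<Rightarrow> branch \<Rightarrow> real \<Rightarrow> real" where
  "feres_map \<alpha> B1 \<theta> = \<theta> + 2 * \<alpha>"
| "feres_map \<alpha> B2 \<theta> = - \<theta> + 2 * pi - 4 * \<alpha>"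
| "feres_map \<alpha> B3 \<theta> = \<theta> - 2 * \<alpha>"
| "feres_map \<alpha> B4 \<theta> = - \<theta> + 4 * \<alpha>"

text \<open>At \<open>\<theta> = \<pi> / 2\<close> both \<open>tan \<theta>\<close> and the quotient are \<open>0\<close> in HOL, so the value is \<open>1 / 2\<close>,
  which is the continuous extension.\<close>

definition feres_u :: "real \<Rightarrow> real \<Rightarrow> real" where
  "feres_u \<beta> \<theta> = (1 + tan \<beta> / tan \<theta>) / 2"

fun feres_prob :: "real \<Rightarrow> branch \<Rightarrow> real \<Rightarrow> real" where
  "feres_prob \<alpha> B1 \<theta> =
     (if \<theta> \<in> {0..<\<alpha>} then 1
      else if \<theta> \<in> {\<alpha>..<pi - 3 * \<alpha>} then feres_u \<alpha> \<theta>
      else if \<theta> \<in> {pi - 3 * \<alpha>..<pi - 2 * \<alpha>} then 2 * cos (2 * \<alpha>) * feres_u (2 * \<alpha>) \<theta>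
      else 0)"
| "feres_prob \<alpha> B2 \<theta> =
     (if \<theta> \<in> {pi - 3 * \<alpha>..<pi - 2 * \<alpha>}
        then feres_u \<alpha> \<theta> - 2 * cos (2 * \<alpha>) * feres_u (2 * \<alpha>) \<theta>
      else if \<theta> \<in> {pi - 2 * \<alpha>..<pi - \<alpha>} then feres_u \<alpha> \<theta>
      else 0)"
| "feres_prob \<alpha> B3 \<theta> =
     (if \<theta> \<in> {2 * \<alpha>..<3 * \<alpha>} then 2 * cos (2 * \<alpha>) * feres_u (2 * \<alpha>) (- \<theta>)
      else if \<theta> \<in> {3 * \<alpha>..<pi - \<alpha>} then feres_u \<alpha> (- \<theta>)
      else if \<theta> \<in> {pi - \<alpha>..pi} then 1
      else 0)"
| "feres_prob \<alpha> B4 \<theta> =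
     (if \<theta> \<in> {\<alpha>..<2 * \<alpha>} then feres_u \<alpha> (- \<theta>)
      else if \<theta> \<in> {2 * \<alpha>..<3 * \<alpha>}
        then feres_u \<alpha> (- \<theta>) - 2 * cos (2 * \<alpha>) * feres_u (2 * \<alpha>) (- \<theta>)
      else 0)"

text \<open>A sequence \<open>(x\<^sub>1, x\<^sub>2, \<dots>)\<close> is indexed from \<open>0\<close>: \<open>x k\<close> is its entry number \<open>k + 1\<close>.\<close>

fun angle_orbit :: "real \<Rightarrow> (nat \<Rightarrow> branch) \<Rightarrow> nat \<Rightarrow> real \<Rightarrow> real" where
  "angle_orbit \<alpha> x 0 \<theta> = \<theta>"
| "angle_orbit \<alpha> x (Suc n) \<theta> = feres_map \<alpha> (x n) (angle_orbit \<alpha> x n \<theta>)"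

definition admissible :: "real \<Rightarrow> real \<Rightarrow> (nat \<Rightarrow> branch) set" where
  "admissible \<alpha> \<theta> =
     {x. \<forall>k\<ge>1. (\<Prod>j<k. feres_prob \<alpha> (x j) (angle_orbit \<alpha> x j \<theta>)) > 0}"

definition billiard_map ::
    "geometry \<Rightarrow> real \<Rightarrow> real \<Rightarrow> branch \<Rightarrow> real \<times> real \<Rightarrow> real \<times> real" where
  "billiard_map M r \<alpha> i = (\<lambda>(s, \<theta>).
     ((s + arc M r (central_angle M r (feres_map \<alpha> i \<theta>))) rmod circ_length M r,
      feres_map \<alpha> i \<theta>))"

fun billiard_iter ::
    "geometry \<Rightarrow> real \<Rightarrow> real \<Rightarrow> (nat \<Rightarrow> branch) \<Rightarrow> nat \<Rightarrow> real \<times> real \<Rightarrow> real \<times> real" where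
  "billiard_iter M r \<alpha> x 0 = id"
| "billiard_iter M r \<alpha> x (Suc n) = billiard_map M r \<alpha> (x n) \<circ> billiard_iter M r \<alpha> x n"

subsection \<open>Derivatives with the first coordinate taken modulo \<open>L\<close>\<close>

text \<open>
  Here \<open>f\<close> is a self-map of \<open>(\<real>/L\<int>) \<times> \<real>\<close> written with representatives in \<open>[0, L)\<close>.  Its
  derivative is the ordinary derivative of a lift \<open>g\<close> defined near \<open>z\<close>; two such lifts differ by a
  locally constant element of \<open>L\<int> \<times> {0}\<close>.
\<close>

definition has_derivative_mod ::
    "real \<Rightarrow> (real \<times> real \<Rightarrow> real \<times> real) \<Rightarrow> (real \<times> real \<Rightarrow> real \<times> real) \<Rightarrow> real \<times> real \<Rightarrow> bool"
  where
  "has_derivative_mod L f D z \<longleftrightarrow>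
     (\<exists>g. (\<forall>\<^sub>F y in nhds z. [fst (g y) = fst (f (fst y rmod L, snd y))] (rmod L) \<and>
                            snd (g y) = snd (f (fst y rmod L, snd y))) \<and>
          (g has_derivative D) (at z))"

definition differentiable_mod ::
    "real \<Rightarrow> (real \<times> real \<Rightarrow> real \<times> real) \<Rightarrow> real \<times> real \<Rightarrow> bool" where
  "differentiable_mod L f z \<longleftrightarrow> (\<exists>D. has_derivative_mod L f D z)"

definition derivative_mod ::
    "real \<Rightarrow> (real \<times> real \<Rightarrow> real \<times> real) \<Rightarrow> real \<times> real \<Rightarrow> real \<times> real \<Rightarrow> real \<times> real" where
  "derivative_mod L f z = (THE D. has_derivative_mod L f D z)"

text \<open>
  \<open>derivative_mod\<close> and \<open>ln\<close> are total in HOL, hence the first conjunct: the derivatives exist and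
  the logarithms are taken of positive numbers.
\<close>

definition has_lyapunov_exponent ::
    "geometry \<Rightarrow> real \<Rightarrow> real \<Rightarrow> (nat \<Rightarrow> branch) \<Rightarrow> real \<times> real \<Rightarrow> real \<times> real \<Rightarrow> real \<Rightarrow> bool" where
  "has_lyapunov_exponent M r \<alpha> x v z e \<longleftrightarrow>
     (\<forall>n. differentiable_mod (circ_length M r) (billiard_iter M r \<alpha> x n) z \<and>
          derivative_mod (circ_length M r) (billiard_iter M r \<alpha> x n) z v \<noteq> 0) \<and>
     (\<lambda>n. 1 / real n * ln (norm (derivative_mod (circ_length M r) (billiard_iter M r \<alpha> x n) z v)))
       \<longlonglongrightarrow> e"

subsection \<open>Closed form of the central angle and uniqueness of the derivative\<close>


lemma sn_cs_sq: "curv M * (sn M t)\<^sup>2 + (cs M t)\<^sup>2 = 1"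
  by (cases M) (auto simp: cosh_square_eq)

lemma sn_half: "sn M t = 2 * sn M (t/2) * cs M (t/2)"
  using sinh_double[of "t/2"] sin_double[of "t/2"] by (cases M) auto

lemma cs_half: "cs M t = 1 - 2 * curv M * (sn M (t/2))\<^sup>2"
  using cosh_double_cosh[of "t/2"] cos_double_sin[of "t/2"] 
  by (cases M) (auto simp: cosh_square_eq)

lemma sn_cs_pos:
  assumes "r > 0" "M = Spherical \<Longrightarrow> r < pi / 2"
  shows "sn M r > 0" "cs M r > 0"
  using assms by (cases M; auto intro: sin_gt_zero cos_gt_zero)+

lemma circ_point_eq: "circ_point M r \<phi> = (sn M r * cos \<phi>, sn M r * sin \<phi>, cs M r)"
  by (simp add: circ_point_def geodesic_def)

lemma trajectory_eq:
  "trajectory M r \<phi> \<theta> t =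
    ((cs M t * sn M r - sn M t * sin \<theta> * cs M r) * cos \<phi> - sn M t * cos \<theta> * sin \<phi>,
     (cs M t * sn M r - sn M t * sin \<theta> * cs M r) * sin \<phi> + sn M t * cos \<theta> * cos \<phi>,
     cs M t * cs M r + curv M * sn M t * sin \<theta> * sn M r)"
  by (simp add: trajectory_def circ_point_eq geodesic_def circ_tangent_def inward_normal_def
        algebra_simps)

lemma rot_norm: "((a::real) * cos p - b * sin p)\<^sup>2 + (a * sin p + b * cos p)\<^sup>2 = a\<^sup>2 + b\<^sup>2"
proof -
  have "((a::real) * cos p - b * sin p)\<^sup>2 + (a * sin p + b * cos p)\<^sup>2 
     = (a\<^sup>2 + b\<^sup>2) * ((sin p)\<^sup>2 + (cos p)\<^sup>2)" by algebra
  thus ?thesis by simp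
qed

lemma hit_imp:
  assumes r: "r > 0" "M = Spherical \<Longrightarrow> r < pi / 2" and t: "t > 0" "M = Spherical \<Longrightarrow> t < 2*pi"
    and h: "trajectory M r \<phi> \<theta> t \<in> geod_circle M r"
  shows "sn M (t/2) * cs M r = cs M (t/2) * sin \<theta> * sn M r"
proof -
  obtain g where g: "trajectory M r \<phi> \<theta> t = circ_point M r g"
    using h by (auto simp: geod_circle_def)
  let ?A = "cs M t * sn M r - sn M t * sin \<theta> * cs M r" and ?B = "sn M t * cos \<theta>"
  have z: "cs M t * cs M r + curv M * sn M t * sin \<theta> * sn M r = cs M r"
    using g by (simp add: trajectory_eq circ_point_eq)
  have "(?A * cos \<phi> - ?B * sin \<phi>)\<^sup>2 + (?A * sin \<phi> + ?B * cos \<phi>)\<^sup>2 = 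
      (sn M r * cos g)\<^sup>2 + (sn M r * sin g)\<^sup>2"
    using g by (simp add: trajectory_eq circ_point_eq)
  hence e: "?A\<^sup>2 + ?B\<^sup>2 = (sn M r)\<^sup>2"
    unfolding rot_norm by (simp add: power_mult_distrib flip: distrib_left)
  have sp: "sn M (t/2) > 0" using t by (cases M) (auto intro: sin_gt_zero)
  show ?thesis
  proof (cases "M = Euclidean")
    case True
    have "(r - t * sin \<theta>)\<^sup>2 + (t * cos \<theta>)\<^sup>2 = r\<^sup>2" using e True by simp
    moreover have "(r - t * sin \<theta>)\<^sup>2 + (t * cos \<theta>)\<^sup>2 = r\<^sup>2 - 2*r*t * sin \<theta> + t\<^sup>2 * ((sin \<theta>)\<^sup>2 + (cos \<theta>)\<^sup>2)"
      by algebra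
    ultimately have "t\<^sup>2 = 2 * r * t * sin \<theta>" by simp
    hence "t * (t - 2 * r * sin \<theta>) = 0" by algebra
    hence "t = 2 * r * sin \<theta>" using t by auto
    thus ?thesis using True by simp
  next
    case False
    hence k: "curv M \<noteq> 0" by (cases M) auto
    have "2 * curv M * sn M (t/2) * (sn M (t/2) * cs M r - cs M (t/2) * sin \<theta> * sn M r) = 0"
    proof -
      have "2 * k * a * (a * c - b * s * h) = 0"
        if "(1 - 2 * k * a\<^sup>2) * c + k * (2 * a * b) * s * h = c" for k a b c s h :: real
      proof -
        have "2 * k * a * (a * c - b * s * h) =
            c - ((1 - 2 * k * a\<^sup>2) * c + k * (2 * a * b) * s * h)"
          by (simp add: algebra_simps power2_eq_square)
        thus ?thesis using that by simp
      qed
      from this[OF z[unfolded sn_half[of M t] cs_half[of M t]]] show ?thesis .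
    qed
    thus ?thesis using k sp by simp
  qed
qed

lemma hit_time_mono:
  assumes "0 < u" "u < t" "M = Spherical \<Longrightarrow> t < pi"
  shows "sn M (u/2) * cs M (t/2) < sn M (t/2) * cs M (u/2)"
proof (cases M)
  case Hyperbolic
  have "tanh (u/2) < tanh (t/2)" using assms by simp
  thus ?thesis using Hyperbolic by (simp add: tanh_def field_simps cosh_real_pos)
next
  case Spherical
  have "sin (t/2 - u/2) > 0" using assms Spherical by (intro sin_gt_zero) auto
  thus ?thesis using Spherical by (simp add: sin_diff algebra_simps)
qed (use assms in auto)

lemma hit_time_exists:
  assumes r: "r > 0" "M = Spherical \<Longrightarrow> r < pi / 2" and th: "0 < \<theta>" "\<theta> < pi"
  obtains t where "t > 0" "M = Spherical \<Longrightarrow> t < pi"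
    "sn M (t/2) * cs M r = cs M (t/2) * sin \<theta> * sn M r"
proof (cases M)
  case Euclidean
  show ?thesis by (rule that[of "2 * sin \<theta> * r"]) (use Euclidean r sin_gt_zero[OF th] in auto)
next
  case Hyperbolic
  let ?y = "sin \<theta> * tanh r"
  have s: "sin \<theta> > 0" "sin \<theta> \<le> 1" using sin_gt_zero[OF th] by auto
  have y: "0 < ?y" "?y < 1" using s r tanh_real_lt_1[of r]
    by (auto intro: order.strict_trans1[OF mult_right_mono[of "sin \<theta>" 1 "tanh r"]])
  have a: "artanh ?y > 0" using y by (simp add: artanh_def)
  have "tanh (artanh y) = y" if "0 < y" "y < 1" for y :: real
  proof -
    have "exp (2 * artanh y) = (1 + y) / (1 - y)" using that by (simp add: artanh_def exp_ln)
    hence "exp (- 2 * artanh y) = (1 - y) / (1 + y)" by (simp add: exp_minus)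
    hence "tanh (artanh y) = (1 - (1 - y) / (1 + y)) / (1 + (1 - y) / (1 + y))"
      by (simp add: tanh_real_altdef)
    also have "\<dots> = y" using that by (simp add: field_simps)
    finally show ?thesis .
  qed
  from this[OF y] have "tanh (artanh ?y) = ?y" .
  hence "sinh (artanh ?y) * cosh r = cosh (artanh ?y) * sin \<theta> * sinh r"
    by (simp add: tanh_def field_simps)
  thus ?thesis using a Hyperbolic by (intro that[of "2 * artanh ?y"]) auto
next
  case Spherical
  let ?y = "sin \<theta> * tan r"
  have "?y > 0" using sin_gt_zero[OF th] r Spherical by (auto intro!: mult_pos_pos tan_gt_zero)
  moreover have "arctan ?y < pi/2" by (rule arctan_ubound)
  moreover have "sin (arctan ?y) * cos r = cos (arctan ?y) * sin \<theta> * sin r"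
    using tan_arctan[of ?y] cos_gt_zero[of r] r Spherical cos_arctan_not_zero[of ?y]
    by (simp add: tan_def field_simps del: tan_arctan)
  ultimately show ?thesis using Spherical by (intro that[of "2 * arctan ?y"]) auto
qed

theorem next_collision_iff:
  fixes \<theta> :: real
  assumes r: "r > 0" "M = Spherical \<Longrightarrow> r < pi / 2" and th: "0 < \<theta>" "\<theta> < pi"
  defines "G \<equiv> pi - 2 * arctan (cs M r * cot \<theta>)"
  shows "next_collision M r \<phi> \<theta> q \<longleftrightarrow> q = circ_point M r (\<phi> + G)"
proof -
  obtain t where t: "t > 0" "M = Spherical \<Longrightarrow> t < pi"
    "sn M (t/2) * cs M r = cs M (t/2) * sin \<theta> * sn M r"
    using hit_time_exists[OF r th] by metis
  define h c s a b k where "h = sn M r" and "c = cs M r" and "s = sin \<theta>" and "a = sn M (t/2)"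
    and "b = cs M (t/2)" and "k = curv M"
  have pos: "h > 0" "c > 0" using sn_cs_pos[OF r] by (auto simp: h_def c_def)
  have s: "s > 0" using sin_gt_zero[OF th] by (simp add: s_def)
  define w where "w = cos \<theta>"
  have sw: "s\<^sup>2 + w\<^sup>2 = 1" by (simp add: s_def w_def)
  have kh: "k * h\<^sup>2 + c\<^sup>2 = 1" and kab: "k * a\<^sup>2 + b\<^sup>2 = 1"
    using sn_cs_sq by (auto simp: k_def h_def c_def a_def b_def)
  have abc: "a * c = b * s * h" using t by (simp add: a_def b_def c_def s_def h_def)
  define D where "D = s\<^sup>2 + c\<^sup>2 * w\<^sup>2"
  have D: "D > 0" using s by (simp add: D_def add_pos_nonneg)
  have bD: "b\<^sup>2 * D = c\<^sup>2" using sw kh kab abc unfolding D_def by algebra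
  have abD: "a * b * D = c * s * h" 
  proof -
    have "c * (a * b * D) = c * (c * s * h)" using bD abc by algebra
    thus ?thesis using pos by simp
  qed
  have snt: "sn M t = 2 * a * b" and cst: "cs M t = 1 - 2 * k * a\<^sup>2"
    using sn_half[of M t] cs_half[of M t] by (auto simp: a_def b_def k_def)
  define e where "e = c * w / s"
  have G: "G = pi - 2 * arctan e" by (simp add: G_def e_def c_def w_def s_def cot_def)
  have qq: "1 + e\<^sup>2 = D / s\<^sup>2" using s by (simp add: e_def D_def field_simps)
  have "cos (arctan e) ^ 2 = s\<^sup>2 / D"
    using qq D s by (simp add: cos_arctan power_divide)
  moreover have "sin (arctan e) = e * cos (arctan e)"
    by (simp add: sin_arctan cos_arctan)
  ultimately have "sin (arctan e) * cos (arctan e) = e * (s\<^sup>2 / D)"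
    and sc2: "cos (arctan e) ^ 2 = s\<^sup>2 / D"
    by (simp_all add: power2_eq_square mult.assoc)
  hence sc1: "sin (arctan e) * cos (arctan e) = c * w * s / D"
    using s by (simp add: e_def power2_eq_square)
  have sG: "sin G * D = 2 * c * w * s"
  proof -
    have "sin G = 2 * (sin (arctan e) * cos (arctan e))" by (simp add: G sin_double)
    thus ?thesis unfolding sc1 using D by simp
  qed
  have cG: "cos G * D = D - 2 * s\<^sup>2"
  proof -
    have "cos G = 1 - 2 * cos (arctan e) ^ 2" by (simp add: G cos_double_cos)
    thus ?thesis unfolding sc2 using D by (simp add: field_simps)
  qed
  have x: "cs M t * h - sn M t * s * c = h * cos G"
  proof -
    have "k * a\<^sup>2 * D = k * s\<^sup>2 * h\<^sup>2"
      using abc abD bD kab kh sw unfolding D_def by algebra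
    hence "(cs M t * h - sn M t * s * c) * D = h * cos G * D" 
      using abD cG kh unfolding snt cst by algebra
    thus ?thesis using D by simp
  qed
  have y: "sn M t * w = h * sin G"
  proof -
    have "(sn M t * w) * D = (h * sin G) * D" using abD sG unfolding snt by algebra
    thus ?thesis using D by simp
  qed
  have z: "cs M t * c + k * sn M t * s * h = c"
    using abc unfolding snt cst by algebra
  have hit: "trajectory M r \<phi> \<theta> t = circ_point M r (\<phi> + G)"
  proof -
    have e: "trajectory M r \<phi> \<theta> t =
     ((cs M t * h - sn M t * s * c) * cos \<phi> - sn M t * w * sin \<phi>,
     (cs M t * h - sn M t * s * c) * sin \<phi> + sn M t * w * cos \<phi>,
     cs M t * c + k * sn M t * s * h)"
      unfolding trajectory_eq h_def s_def c_def w_def k_def ..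
    show ?thesis unfolding e x y z
      by (simp add: circ_point_eq h_def c_def cos_add sin_add algebra_simps)
  qed
  have in_c: "circ_point M r g \<in> geod_circle M r" for g by (simp add: geod_circle_def)
  have no: "trajectory M r \<phi> \<theta> u \<notin> geod_circle M r" if "0 < u" "u < t" for u
  proof
    assume "trajectory M r \<phi> \<theta> u \<in> geod_circle M r"
    hence u: "sn M (u/2) * c = cs M (u/2) * s * h"
      using hit_imp[where t = u and \<phi> = \<phi> and \<theta> = \<theta>, OF r] that t(2) pi_gt_zero unfolding c_def s_def h_def
      by force
    have bp: "b > 0" using t by (cases M) (auto simp: b_def intro!: cos_gt_zero)
    have "(sn M (u/2) * b) * c = (a * cs M (u/2)) * c" using u abc by algebra
    hence "sn M (u/2) * b = a * cs M (u/2)" using pos by simp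
    thus False using hit_time_mono[where u = u and t = t and M = M] that t by (auto simp: a_def b_def)
  qed
  show ?thesis
  proof
    assume q: "next_collision M r \<phi> \<theta> q"
    then obtain u where u: "u > 0" "trajectory M r \<phi> \<theta> u = q" "q \<in> geod_circle M r"
      "\<And>v. 0 < v \<Longrightarrow> v < u \<Longrightarrow> trajectory M r \<phi> \<theta> v \<notin> geod_circle M r"
      unfolding next_collision_def by blast
    have "u = t"
      using u no[of u] u(4)[of t] t(1) hit in_c by (metis linorder_neqE_linordered_idom)
    thus "q = circ_point M r (\<phi> + G)" using u hit by simp
  next
    assume "q = circ_point M r (\<phi> + G)"
    thus "next_collision M r \<phi> \<theta> q"
      unfolding next_collision_def using t(1) hit in_c no by metis
  qed
qed

theorem central_angle_eq:
  assumes r: "r > 0" "M = Spherical \<Longrightarrow> r < pi / 2" and th: "0 < \<theta>" "\<theta> < pi"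
  shows "central_angle M r \<theta> = pi - 2 * arctan (cs M r * cot \<theta>)"
proof -
  define G where "G = pi - 2 * arctan (cs M r * cot \<theta>)"
  have G: "0 < G" "G < 2 * pi"
    using arctan_bounded[of "cs M r * cot \<theta>"] by (auto simp: G_def)
  have "(THE g. 0 < g \<and> g < 2 * pi \<and>
              (\<forall>\<phi>. next_collision M r \<phi> \<theta> (circ_point M r (\<phi> + g)))) = G"
  proof (rule the_equality)
    fix g assume g: "0 < g \<and> g < 2 * pi \<and>
              (\<forall>\<phi>. next_collision M r \<phi> \<theta> (circ_point M r (\<phi> + g)))"
    hence "circ_point M r (0 + g) = circ_point M r (0 + G)"
      using next_collision_iff[OF r th] unfolding G_def by blast
    hence "cos g = cos G" "sin g = sin G"
      using sn_cs_pos[of r M, OF r] by (auto simp: circ_point_eq)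
    hence "cis g = cis G" by (simp add: complex_eq_iff)
    hence "[g = G] (rmod (2 * pi))" by (simp add: cis_eq_iff)
    thus "g = G" using g G by (simp add: rcong_def)
  qed (use G next_collision_iff[OF r th] in \<open>auto simp: G_def\<close>)
  thus ?thesis using th by (simp add: central_angle_def G_def)
qed

corollary central_angle_half_pi:
  assumes "r > 0" "M = Spherical \<Longrightarrow> r < pi / 2"
  shows "central_angle M r (pi / 2) = pi"
  using central_angle_eq[OF assms, where \<theta> = "pi / 2"] by (simp add: cot_def)

corollary tan_half_central_angle:
  assumes "r > 0" "M = Spherical \<Longrightarrow> r < pi / 2" "0 < \<theta>" "\<theta> < pi" "\<theta> \<noteq> pi / 2"
  shows "tan (central_angle M r \<theta> / 2) = tan \<theta> / cs M r"
proof -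
  have "central_angle M r \<theta> / 2 = pi / 2 - arctan (cs M r * cot \<theta>)"
    using central_angle_eq[of r M \<theta>, OF assms(1-4)] assms by (simp add: field_simps)
  moreover have "tan (pi / 2 - arctan y) = inverse y" for y :: real
    using tan_cot[of "arctan y"] by (simp add: tan_arctan)
  ultimately have "tan (central_angle M r \<theta> / 2) = inverse (cs M r * cot \<theta>)"
    by (simp only:)
  thus ?thesis by (simp add: cot_def tan_def field_simps)
qed

corollary central_angle_strict_mono:
  assumes "r > 0" "M = Spherical \<Longrightarrow> r < pi / 2"
  shows "strict_mono_on {0..pi} (central_angle M r)"
proof (rule strict_mono_onI)
  fix a b assume ab: "a \<in> {0..pi}" "b \<in> {0..pi}" "a < b"
  have in01: "0 < central_angle M r y" "central_angle M r y < 2 * pi" if "0 < y" "y < pi" for y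
    using central_angle_eq[OF assms that] arctan_bounded[of "cs M r * cot y"] by auto
  have e: "central_angle M r 0 = 0" "central_angle M r pi = 2 * pi"
    using pi_gt_zero by (auto simp: central_angle_def simp del: pi_gt_zero)
  consider "a = 0" "b = pi" | "a = 0" "b < pi" | "a > 0" "b = pi" | "a > 0" "b < pi"
    using ab by force
  thus "central_angle M r a < central_angle M r b"
  proof cases
    case 4
    have "sin (b - a) > 0" "sin a > 0" "sin b > 0" using ab 4 by (auto intro!: sin_gt_zero)
    hence "cot b < cot a" by (simp add: cot_def sin_diff field_simps)
    hence "cs M r * cot b < cs M r * cot a" using sn_cs_pos[OF assms] by simp
    thus ?thesis using 4 ab by (simp add: central_angle_eq[OF assms] arctan_less_iff)
  qed (use in01 e ab in auto)
qed

text \<open>Two lifts have the same derivative, so \<open>derivative_mod\<close> is well defined.\<close>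

lemma has_derivative_mod_unique:
  assumes L: "L > 0" and D: "has_derivative_mod L f D z" "has_derivative_mod L f D' z"
  shows "D = D'"
proof -
  obtain g g' where
    g: "\<forall>\<^sub>F y in nhds z. [fst (g y) = fst (f (fst y rmod L, snd y))] (rmod L) \<and>
                            snd (g y) = snd (f (fst y rmod L, snd y))" "(g has_derivative D) (at z)"
    and g': "\<forall>\<^sub>F y in nhds z. [fst (g' y) = fst (f (fst y rmod L, snd y))] (rmod L) \<and>
                            snd (g' y) = snd (f (fst y rmod L, snd y))" "(g' has_derivative D') (at z)"
    using D unfolding has_derivative_mod_def by blast
  define d where "d y = g y - g' y" for y
  have dd: "(d has_derivative (\<lambda>v. D v - D' v)) (at z)"
    unfolding d_def by (intro derivative_intros g g')
  have ev: "\<forall>\<^sub>F y in nhds z. \<exists>n::int. d y = (of_int n * L, 0)"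
    using g(1) g'(1)
  proof eventually_elim
    case (elim y)
    hence "[fst (g' y) = fst (g y)] (rmod L)" "snd (g y) = snd (g' y)"
      by (auto intro: rcong_trans rcong_sym)
    thus ?case by (auto simp: d_def rcong_altdef prod_eq_iff)
  qed
  from eventually_nhds_x_imp_x[OF ev] obtain m :: int where m: "d z = (of_int m * L, 0)" by blast
  have "(d \<longlongrightarrow> d z) (at z)"
    using has_derivative_continuous[OF dd] by (simp add: isCont_def)
  hence "(d \<longlongrightarrow> d z) (nhds z)"
    by (simp add: tendsto_at_iff_tendsto_nhds)
  hence "\<forall>\<^sub>F y in nhds z. dist (d y) (d z) < L" using L by (auto simp: tendsto_iff)
  with ev have c: "\<forall>\<^sub>F y in nhds z. d y = d z"
  proof eventually_elim
    case (elim y)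
    then obtain n :: int where n: "d y = (of_int n * L, 0)" by blast
    have "\<bar>of_int n * L - of_int m * L\<bar> < L"
      using elim(2) by (simp add: n m dist_Pair_Pair dist_real_def)
    hence "\<bar>of_int (n - m)\<bar> * L < 1 * L" using L by (simp add: abs_mult flip: left_diff_distrib)
    hence "\<bar>of_int (n - m) :: real\<bar> < 1" using L by (simp only: mult_less_cancel_right_pos)
    hence "n = m" by linarith
    thus ?case using n m by simp
  qed
  have "((\<lambda>_. d z) has_derivative (\<lambda>v. D v - D' v)) (at z)"
  proof (rule has_derivative_transform_eventually[OF dd])
    show "\<forall>\<^sub>F y in at z. d y = d z" using c by (auto simp: eventually_at_filter elim: eventually_mono)
  qed auto
  from has_derivative_unique[OF this has_derivative_const] show ?thesis
    by (auto simp: fun_eq_iff)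
qed

corollary derivative_mod_eq:
  assumes "L > 0" "has_derivative_mod L f D z"
  shows "derivative_mod L f z = D"
  unfolding derivative_mod_def using assms has_derivative_mod_unique by blast

end

theory Submission
  imports Defs "HOL-Real_Asymp.Real_Asymp"
begin

text \<open>
  With the indices held fixed, every iterate is a shear composed with a reflection or the identity:
  the angle enters the first coordinate through a sum of \<open>n\<close> terms \<open>h \<gamma>(\<theta>\<^sub>k)\<close>, where
  \<open>\<theta>\<^sub>k = \<plusminus>\<theta> + const\<close>.  Since
  \<open>\<gamma>'(\<theta>) = 2 c / (sin\<^sup>2 \<theta> + c\<^sup>2 cos\<^sup>2 \<theta>)\<close> is bounded, the derivative of the \<open>n\<close>-th iterate
  grows at most linearly in \<open>n\<close>; as the second component of a vector only changes its sign, the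
  image of a nonzero vector also stays away from \<open>0\<close>.  Admissibility keeps the angles in
  \<open>(0, \<pi>)\<close>, where \<open>\<gamma>\<close> is differentiable.
\<close>

text \<open>Squeeze: \<open>ln m / n\<close> and \<open>ln (A + B * n) / n\<close> both tend to 0.
  The bound \<open>m > 0\<close> keeps the logarithm from drifting to minus infinity.\<close>

lemma tendsto_ln_over_n_linear_growth:
  fixes a :: "nat \<Rightarrow> real"
  assumes m: "m > 0" "\<And>n. m \<le> a n" and A: "A > 0" "B > 0" "\<And>n. a n \<le> A + B * real n"
  shows "(\<lambda>n. 1 / real n * ln (a n)) \<longlonglongrightarrow> 0"
proof (rule tendsto_sandwich)
  show "(\<lambda>n. 1 / real n * ln m) \<longlonglongrightarrow> 0"
    by real_asymp
  show "(\<lambda>n. 1 / real n * ln (A + B * real n)) \<longlonglongrightarrow> 0"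
    using A(1,2) by real_asymp
  have pos: "a n > 0" for n using m order.strict_trans2 by blast
  have "ln m \<le> ln (a n)" "ln (a n) \<le> ln (A + B * real n)" for n
    using m A(3)[of n] pos[of n] by (auto intro!: ln_mono)
  \<comment> \<open>These hold for every \<open>n\<close>: at \<open>n = 0\<close> both sides are 0,
    because \<open>1 / 0 = 0\<close>.\<close>
  thus "\<forall>\<^sub>F n in sequentially. 1 / real n * ln m \<le> 1 / real n * ln (a n)"
    "\<forall>\<^sub>F n in sequentially. 1 / real n * ln (a n) \<le> 1 / real n * ln (A + B * real n)"
    by (auto intro!: always_eventually mult_left_mono divide_right_mono)
qed

definition central_angle_deriv :: "geometry \<Rightarrow> real \<Rightarrow> real \<Rightarrow> real" where
  "central_angle_deriv M r \<theta> = 2 * cs M r / ((sin \<theta>)\<^sup>2 + (cs M r)\<^sup>2 * (cos \<theta>)\<^sup>2)"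

lemma central_angle_has_derivative:
  assumes r: "r > 0" "M = Spherical \<Longrightarrow> r < pi / 2" and th: "0 < \<theta>" "\<theta> < pi"
  shows "(central_angle M r has_real_derivative central_angle_deriv M r \<theta>) (at \<theta>)"
proof -
  define c where "c = cs M r"
  have s: "sin \<theta> > 0" using sin_gt_zero[OF th] .
  have D: "(sin \<theta>)\<^sup>2 + c\<^sup>2 * (cos \<theta>)\<^sup>2 > 0" using s by (simp add: add_pos_nonneg)
  have "((\<lambda>\<theta>. pi - 2 * arctan (c * cot \<theta>)) has_real_derivative
      2 * (c * inverse ((sin \<theta>)\<^sup>2)) / (1 + (c * cot \<theta>)\<^sup>2)) (at \<theta>)"
    using s by (auto intro!: derivative_eq_intros DERIV_cot simp: divide_inverse)
  also have "2 * (c * inverse ((sin \<theta>)\<^sup>2)) / (1 + (c * cot \<theta>)\<^sup>2) = central_angle_deriv M r \<theta>"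
  proof -
    have "1 + (c * cot \<theta>)\<^sup>2 = ((sin \<theta>)\<^sup>2 + c\<^sup>2 * (cos \<theta>)\<^sup>2) / (sin \<theta>)\<^sup>2"
      using s by (simp add: cot_def field_simps)
    thus ?thesis using s D by (simp add: central_angle_deriv_def c_def[symmetric] field_simps)
  qed
  finally show ?thesis
  \<comment> \<open>The arctan form of \<open>central_angle\<close> is available on the open
    interval (0, pi), a neighbourhood of \<open>\<theta>\<close>, which suffices for the
    derivative.\<close>
  proof (rule has_field_derivative_transform_within_open)
    show "pi - 2 * arctan (c * cot y) = central_angle M r y" if "y \<in> {0<..<pi}" for y
      using central_angle_eq[OF r, where \<theta> = y] that by (simp add: c_def)
  qed (use th in auto)
qed

text \<open>With \<open>c = cs M r\<close>, the bound \<open>2 * (c + 1 / c)\<close> replaces the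
  maximum of \<open>c\<close> and \<open>1 / c\<close> by their sum, so that
  \<open>c \<le> 1\<close> and \<open>c \<ge> 1\<close>, hence all three geometries, are treated at
  once.\<close>

lemma central_angle_deriv_bound:
  assumes r: "r > 0" "M = Spherical \<Longrightarrow> r < pi / 2"
  shows "\<bar>central_angle_deriv M r \<theta>\<bar> \<le> 2 * (1 + (cs M r)\<^sup>2) / cs M r"
proof -
  define c where "c = cs M r"
  define D where "D = (sin \<theta>)\<^sup>2 + c\<^sup>2 * (cos \<theta>)\<^sup>2"
  have c: "c > 0" using sn_cs_pos[of r M, OF r] by (simp add: c_def)
  have sc: "(sin \<theta>)\<^sup>2 + (cos \<theta>)\<^sup>2 = 1" by simp
  have "(1 + c\<^sup>2) * D = c\<^sup>2 + ((sin \<theta>)\<^sup>2 + (c\<^sup>2)\<^sup>2 * (cos \<theta>)\<^sup>2)"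
    unfolding D_def using sc by algebra
  hence le: "c\<^sup>2 \<le> (1 + c\<^sup>2) * D" by simp
  have "D > 0"
  proof (rule ccontr)
    assume "\<not> D > 0"
    hence "(1 + c\<^sup>2) * D \<le> 0" by (simp add: mult_nonneg_nonpos)
    with le c show False using zero_less_power2[of c] by linarith
  qed
  hence "\<bar>2 * c / D\<bar> = 2 * c / D" using c by simp
  also have "\<dots> \<le> 2 * (1 + c\<^sup>2) / c"
    using le c \<open>D > 0\<close> by (simp add: divide_simps power2_eq_square) (simp add: algebra_simps)
  finally show ?thesis by (simp add: central_angle_deriv_def D_def c_def)
qed

text \<open>The only boundary case is \<open>B3\<close> at \<open>\<theta> = 2\<alpha>\<close>, which is sent to \<open>0\<close> but has probability
  \<open>2 cos(2\<alpha>) u\<^bsub>2\<alpha>\<^esub>(-2\<alpha>) = 0\<close>.\<close>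

lemma feres_map_interior:
  assumes a: "0 < \<alpha>" "\<alpha> < pi / 6" and th: "\<theta> \<in> {0<..<pi}" and p: "feres_prob \<alpha> i \<theta> \<noteq> 0"
  shows "feres_map \<alpha> i \<theta> \<in> {0<..<pi}"
proof (cases i)
  case B3
  have "tan (2 * \<alpha>) > 0" using a by (intro tan_gt_zero) auto
  hence "feres_u (2 * \<alpha>) (- (2 * \<alpha>)) = 0" by (simp add: feres_u_def)
  hence "\<theta> \<noteq> 2 * \<alpha>" using p B3 a by auto
  thus ?thesis using assms B3 by (auto split: if_splits)
qed (use assms in \<open>auto split: if_splits\<close>)

lemma angle_orbit_interior:
  assumes a: "0 < \<alpha>" "\<alpha> < pi / 6" and th: "\<theta> \<in> {0<..<pi}" and x: "x \<in> admissible \<alpha> \<theta>"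
  shows "angle_orbit \<alpha> x n \<theta> \<in> {0<..<pi}"
proof (induction n)
  case (Suc n)
  have "(\<Prod>j<Suc n. feres_prob \<alpha> (x j) (angle_orbit \<alpha> x j \<theta>)) > 0"
    using x by (simp add: admissible_def del: prod.lessThan_Suc)
  \<comment> \<open>A positive product has no zero factor; the signs of the single factors do not
    matter.\<close>
  hence "feres_prob \<alpha> (x n) (angle_orbit \<alpha> x n \<theta>) \<noteq> 0" by auto
  from feres_map_interior[OF a Suc.IH this] show ?case by simp
qed (use th in simp)

fun branch_sign :: "branch \<Rightarrow> real" where
  "branch_sign B1 = 1"
| "branch_sign B2 = - 1"
| "branch_sign B3 = 1"
| "branch_sign B4 = - 1"

definition orbit_sign :: "(nat \<Rightarrow> branch) \<Rightarrow> nat \<Rightarrow> real" where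
  "orbit_sign x n = (\<Prod>k<n. branch_sign (x k))"

lemma abs_orbit_sign: "\<bar>orbit_sign x n\<bar> = 1"
proof -
  have "\<bar>branch_sign i\<bar> = 1" for i by (cases i) auto
  thus ?thesis by (simp add: orbit_sign_def abs_prod)
qed

lemma feres_map_has_derivative:
  "(feres_map \<alpha> i has_real_derivative branch_sign i) (at \<theta>)"
proof -
  have "feres_map \<alpha> i = (\<lambda>t. branch_sign i * t + feres_map \<alpha> i 0)"
    by (cases i) (auto simp: fun_eq_iff)
  moreover have "((\<lambda>t. branch_sign i * t + feres_map \<alpha> i 0) has_real_derivative branch_sign i) (at \<theta>)"
    by (auto intro!: derivative_eq_intros)
  ultimately show ?thesis by simp
qed

lemma angle_orbit_has_derivative:
  "(angle_orbit \<alpha> x n has_real_derivative orbit_sign x n) (at \<theta>)"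
proof (induction n)
  case 0
  have "angle_orbit \<alpha> x 0 = (\<lambda>t. t)" by auto
  thus ?case by (simp add: orbit_sign_def)
next
  case (Suc n)
  have "angle_orbit \<alpha> x (Suc n) = (\<lambda>t. feres_map \<alpha> (x n) (angle_orbit \<alpha> x n t))" by auto
  thus ?case
    using DERIV_chain2[OF feres_map_has_derivative Suc.IH]
    by (simp add: orbit_sign_def mult.commute)
qed

text \<open>All reductions modulo the length are dropped, so there are no jumps to differentiate
  across. The index is \<open>Suc k\<close> because a step moves the point by the central angle of
  the new direction, after the branch has been applied.\<close>

definition billiard_lift ::
    "geometry \<Rightarrow> real \<Rightarrow> real \<Rightarrow> (nat \<Rightarrow> branch) \<Rightarrow> nat \<Rightarrow> real \<times> real \<Rightarrow> real \<times> real" where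
  "billiard_lift M r \<alpha> x n y =
     (fst y + (\<Sum>k<n. arc M r (central_angle M r (angle_orbit \<alpha> x (Suc k) (snd y)))),
      angle_orbit \<alpha> x n (snd y))"

text \<open>The displacements depend on the angle only, and congruence is compatible with addition,
  so every reduction can be postponed to the end.\<close>

lemma billiard_lift_cong:
  "[fst (billiard_lift M r \<alpha> x n y) =
     fst (billiard_iter M r \<alpha> x n (fst y rmod circ_length M r, snd y))] (rmod circ_length M r) \<and>
   snd (billiard_lift M r \<alpha> x n y) =
     snd (billiard_iter M r \<alpha> x n (fst y rmod circ_length M r, snd y))"
proof (induction n)
  case 0
  show ?case by (simp add: billiard_lift_def rcong_def)
next
  case (Suc n)
  obtain a b where ab:
    "billiard_iter M r \<alpha> x n (fst y rmod circ_length M r, snd y) = (a, b)" by fastforce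
  let ?d = "arc M r (central_angle M r (angle_orbit \<alpha> x (Suc n) (snd y)))"
  have b: "b = angle_orbit \<alpha> x n (snd y)"
    and "[fst (billiard_lift M r \<alpha> x n y) = a] (rmod circ_length M r)"
    using Suc.IH ab by (auto simp: billiard_lift_def)
  from this(2) have "[fst (billiard_lift M r \<alpha> x n y) + ?d = a + ?d] (rmod circ_length M r)"
    by (intro rcong_intros) auto
  thus ?case using ab b
    by (simp add: billiard_lift_def billiard_map_def rcong_def add.assoc)
qed

text \<open>The off-diagonal entry of the triangular derivative matrix, whose diagonal is
  \<open>1\<close>, \<open>orbit_sign x n\<close>.\<close>

definition shear_coeff ::
    "geometry \<Rightarrow> real \<Rightarrow> real \<Rightarrow> (nat \<Rightarrow> branch) \<Rightarrow> nat \<Rightarrow> real \<Rightarrow> real" where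
  "shear_coeff M r \<alpha> x n \<theta> =
     (\<Sum>k<n. sn M r * (central_angle_deriv M r (angle_orbit \<alpha> x (Suc k) \<theta>) * orbit_sign x (Suc k)))"

lemma billiard_iter_has_derivative_mod:
  assumes r: "r > 0" "M = Spherical \<Longrightarrow> r < pi / 2"
    and int: "\<And>k. angle_orbit \<alpha> x k \<theta> \<in> {0<..<pi}"
  shows "has_derivative_mod (circ_length M r) (billiard_iter M r \<alpha> x n)
           (\<lambda>v. (fst v + shear_coeff M r \<alpha> x n \<theta> * snd v, orbit_sign x n * snd v)) (s, \<theta>)"
proof -
  have "((\<lambda>t. arc M r (central_angle M r (angle_orbit \<alpha> x (Suc k) t))) has_real_derivative
      sn M r * (central_angle_deriv M r (angle_orbit \<alpha> x (Suc k) \<theta>) * orbit_sign x (Suc k))) (at \<theta>)"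
    for k
    unfolding arc_def
    by (intro DERIV_cmult DERIV_chain2[OF central_angle_has_derivative angle_orbit_has_derivative])
      (use r int[of "Suc k"] in auto)
  hence sum: "((\<lambda>t. \<Sum>k<n. arc M r (central_angle M r (angle_orbit \<alpha> x (Suc k) t)))
      has_real_derivative shear_coeff M r \<alpha> x n \<theta>) (at \<theta>)"
    unfolding shear_coeff_def by (intro DERIV_sum)
  \<comment> \<open>Chain rule through the second projection: it turns derivatives in the angle into
    derivatives on the plane.\<close>
  have comp: "((\<lambda>y. f (snd y)) has_derivative (\<lambda>v. d * snd v)) (at (s, \<theta>))"
    if "(f has_real_derivative d) (at \<theta>)" for f :: "real \<Rightarrow> real" and d
    using has_derivative_compose[OF has_derivative_snd[OF has_derivative_ident], of f _ "(s, \<theta>)"]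
      that by (force simp: has_field_derivative_def)
  have "(billiard_lift M r \<alpha> x n has_derivative
      (\<lambda>v. (fst v + shear_coeff M r \<alpha> x n \<theta> * snd v, orbit_sign x n * snd v))) (at (s, \<theta>))"
    unfolding billiard_lift_def[abs_def]
    by (intro has_derivative_Pair has_derivative_add has_derivative_fst has_derivative_ident
        comp[OF sum] comp[OF angle_orbit_has_derivative])
  thus ?thesis
    unfolding has_derivative_mod_def using billiard_lift_cong by (blast intro: always_eventually)
qed

text \<open>Each of the \<open>n\<close> summands is bounded uniformly in the angle; no cancellation
  between opposite signs is used.\<close>

lemma abs_shear_coeff_le:
  assumes r: "r > 0" "M = Spherical \<Longrightarrow> r < pi / 2"
  shows "\<bar>shear_coeff M r \<alpha> x n \<theta>\<bar> \<le> sn M r * (2 * (1 + (cs M r)\<^sup>2) / cs M r) * real n"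
proof -
  have "\<bar>sn M r * (central_angle_deriv M r t * orbit_sign x k)\<bar>
      \<le> sn M r * (2 * (1 + (cs M r)\<^sup>2) / cs M r)" for t k
    using mult_left_mono[OF central_angle_deriv_bound[of r M t, OF r], of "sn M r"]
      sn_cs_pos(1)[of r M, OF r]
    by (simp add: abs_mult abs_orbit_sign)
  hence "\<bar>shear_coeff M r \<alpha> x n \<theta>\<bar> \<le> (\<Sum>k<n. sn M r * (2 * (1 + (cs M r)\<^sup>2) / cs M r))"
    unfolding shear_coeff_def by (intro order_trans[OF sum_abs] sum_mono)
  thus ?thesis by (simp add: mult.commute)
qed

theorem proposition5p3:
  fixes M :: geometry and r0 \<alpha> s \<theta> :: real
    and x :: "nat \<Rightarrow> branch" and v :: "real \<times> real"
  assumes "r0 > 0" and "M = Spherical \<Longrightarrow> r0 < pi / 2"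
    and "0 < \<alpha>" and "\<alpha> < pi / 6"
    and "s \<in> {0..<circ_length M r0}" and "\<theta> \<in> {0<..<pi}"
    and "x \<in> admissible \<alpha> \<theta>" and "v \<noteq> 0"
  shows "has_lyapunov_exponent M r0 \<alpha> x v (s, \<theta>) 0"
proof -
  note r = assms(1,2)
  define L where "L = circ_length M r0"
  have L: "L > 0" using sn_cs_pos(1)[of r0 M, OF r] by (simp add: L_def circ_length_def)
  obtain v1 v2 where v: "v = (v1, v2)" by fastforce
  define w where "w n = (v1 + shear_coeff M r0 \<alpha> x n \<theta> * v2, orbit_sign x n * v2)" for n
  have D: "has_derivative_mod L (billiard_iter M r0 \<alpha> x n)
      (\<lambda>v. (fst v + shear_coeff M r0 \<alpha> x n \<theta> * snd v, orbit_sign x n * snd v)) (s, \<theta>)" for n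
    unfolding L_def
    using billiard_iter_has_derivative_mod[OF r] angle_orbit_interior[OF assms(3,4,6,7)] by blast
  have Dv: "derivative_mod L (billiard_iter M r0 \<alpha> x n) (s, \<theta>) v = w n" for n
    by (simp add: derivative_mod_eq[OF L D] w_def v)
  define C where "C = sn M r0 * (2 * (1 + (cs M r0)\<^sup>2) / cs M r0)"
  have C: "C \<ge> 0" using sn_cs_pos[of r0 M, OF r] by (simp add: C_def)
  \<comment> \<open>If \<open>v2 = 0\<close> the shear does nothing and the image is
    \<open>(v1, 0)\<close>; otherwise the second component alone has size
    \<open>\<bar>v2\<bar>\<close>.\<close>
  define m where "m = (if v2 = 0 then \<bar>v1\<bar> else \<bar>v2\<bar>)"
  have m: "m > 0" using assms(8) by (auto simp: m_def v zero_prod_def)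
  have lower: "m \<le> norm (w n)" for n
  proof (cases "v2 = 0")
    case True
    thus ?thesis by (simp add: m_def w_def norm_Pair)
  next
    case False
    have "\<bar>v2\<bar> = norm (snd (w n))" by (simp add: w_def abs_mult abs_orbit_sign)
    thus ?thesis using False norm_snd_le[of "snd (w n)" "fst (w n)"] by (simp add: m_def)
  qed
  \<comment> \<open>The added ones make both constants strictly positive, as the growth lemma
    demands; \<open>C * \<bar>v2\<bar>\<close> vanishes when \<open>v2 = 0\<close>.\<close>
  have upper: "norm (w n) \<le> (\<bar>v1\<bar> + \<bar>v2\<bar> + 1) + (C * \<bar>v2\<bar> + 1) * real n" for n
  proof -
    have "norm (w n) \<le> \<bar>v1 + shear_coeff M r0 \<alpha> x n \<theta> * v2\<bar> + \<bar>orbit_sign x n * v2\<bar>"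
      unfolding w_def by (metis norm_Pair_le real_norm_def)
    also have "\<dots> \<le> \<bar>v1\<bar> + \<bar>shear_coeff M r0 \<alpha> x n \<theta>\<bar> * \<bar>v2\<bar> + \<bar>v2\<bar>"
      by (simp add: abs_mult abs_orbit_sign abs_triangle_ineq[THEN order_trans])
    also have "\<dots> \<le> \<bar>v1\<bar> + (C * real n) * \<bar>v2\<bar> + \<bar>v2\<bar>"
      unfolding C_def using abs_shear_coeff_le[of r0 M \<alpha> x n \<theta>, OF r]
      by (intro add_mono mult_right_mono) auto
    finally show ?thesis by (simp add: algebra_simps)
  qed
  have "(\<lambda>n. 1 / real n * ln (norm (w n))) \<longlonglongrightarrow> 0"
    using m lower _ _ upper by (rule tendsto_ln_over_n_linear_growth)
      (use C in \<open>auto intro!: add_nonneg_pos\<close>)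
  moreover have "w n \<noteq> 0" for n using lower[of n] m by auto
  ultimately show ?thesis
    unfolding has_lyapunov_exponent_def differentiable_mod_def L_def[symmetric] Dv using D by blast
qed

end
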